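(* Let $X\subseteq U$ be a fixed set of $|X|=m$ keys and let $h:U\to[n]$ be a simple tabulation hash function. Then with high probability $$|h(X)|\ge n\left(1-\left(1-\frac1n\right)^{\Omega(m)}\right);$$ that is, for every constant $\gamma>0$ there is a constant $\beta>0$ (depending only on $\gamma$ and $c$) such that $|h(X)|\ge n\left(1-(1-1/n)^{m/\beta}\right)$ with probability at least $1-O(n^{-\gamma})$.
   Context: Simple tabulation hashing: the key universe is $U=[u]$, each key $x\in U$ is viewed as a vector $(x[0],\dots,x[c-1])$ of $c=O(1)$ characters from $\Sigma=[u^{1/c}]$; the range is $[n]=[2^r]$. $h(x)=h_0(x[0])\oplus\cdots\oplus h_{c-1}(x[c-1])$ with $h_0,\dots,h_{c-1}:\Sigma\to[2^r]$ independent fully random functions and $\oplus$ bitwise XOR. "With high probability" means with probability $1-O(n^{-\gamma})$ for any prescribed constant $\gamma>0$. *)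

theory Defs
  imports "HOL-Probability.Probability"
begin

text \<open>Keys: vectors of c characters from the alphabet [s] = {0..<s}; the key universe
  [u] with u = s^c is identified with these vectors.\<close>
definition keys :: "nat \<Rightarrow> nat \<Rightarrow> nat list set" where
  "keys c s = {x. length x = c \<and> (\<forall>i<c. x ! i < s)}"

text \<open>Tables: T (i, a) = h_i(a) \<in> [2^r] for i < c, a < s (extensional elsewhere).\<close>
definition tables :: "nat \<Rightarrow> nat \<Rightarrow> nat \<Rightarrow> (nat \<times> nat \<Rightarrow> nat) set" where
  "tables c s r = Pi\<^sub>E ({..<c} \<times> {..<s}) (\<lambda>_. {..<2^r})"

definition tab_hash :: "nat \<Rightarrow> (nat \<times> nat \<Rightarrow> nat) \<Rightarrow> nat list \<Rightarrow> nat" where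
  "tab_hash c T x = fold (\<lambda>i acc. Bit_Operations.xor acc (T (i, x ! i))) [0..<c] 0"

definition table_pmf :: "nat \<Rightarrow> nat \<Rightarrow> nat \<Rightarrow> (nat \<times> nat \<Rightarrow> nat) pmf" where
  "table_pmf c s r = pmf_of_set (tables c s r)"

end

theory Submission
  imports Defs "HOL-Real_Asymp.Real_Asymp"
begin

text \<open>
  Write \<open>n = 2^r\<close>, \<open>m = |X|\<close>, and let \<open>L\<close> be the number of empty bins. In every set of \<open>m\<close> keys
  some character is shared by a group \<open>G\<close> of at most \<open>m powr (1 - 1/c)\<close> keys; peeling such groups
  one after the other exhibits \<open>h(X)\<close> as a union of sets \<open>h(G)\<close>, each translated by a uniform value
  independent of the groups peeled after it. If \<open>m\<close> is at most \<open>n powr (1 + 1/(2c))\<close>, the groups are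
  polynomially smaller than \<open>n\<close>, so with high probability no bin contains more than a constant
  number \<open>d = k^c\<close> of keys of any one group: more than \<open>k^c\<close> keys in a bin include \<open>k + 1\<close> keys with
  pairwise distinct characters at one position, and those hash independently. Hence
  \<open>|h(G)| \<ge> |G| / d\<close>, and a group multiplies the expectation of \<open>L powr t\<close> by at most
  \<open>exp (- t |G| / (2 d n))\<close>, as long as \<open>t |G| \<le> L\<close> or \<open>t \<le> 1\<close>.

  Markov's inequality for \<open>L powr t\<close> with a polynomially large \<open>t m / n\<close> settles \<open>m = O(n ln n)\<close>;
  for larger \<open>m\<close>, the case \<open>t = 1\<close> applied to a subset of \<open>\<Theta>(n ln n)\<close> keys shows that no bin is
  empty. If \<open>m\<close> is polynomially smaller than \<open>n\<close>, the bound on the loads suffices.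
\<close>

section \<open>Discrete probability\<close>

lemma measure_pmf_Collect_mono:
  assumes "\<And>x. x \<in> set_pmf M \<Longrightarrow> P x \<Longrightarrow> Q x"
  shows "measure_pmf.prob M {x. P x} \<le> measure_pmf.prob M {x. Q x}"
  using assms by (intro measure_pmf.finite_measure_mono_AE) (auto simp: AE_measure_pmf_iff)

lemma measure_pmf_Bex_le:
  assumes "finite A" "\<And>a. a \<in> A \<Longrightarrow> measure_pmf.prob M {x. P a x} \<le> p"
  shows "measure_pmf.prob M {x. \<exists>a\<in>A. P a x} \<le> real (card A) * p"
proof -
  have "{x. \<exists>a\<in>A. P a x} = (\<Union>a\<in>A. {x. P a x})"
    by auto
  then have "measure_pmf.prob M {x. \<exists>a\<in>A. P a x} \<le> (\<Sum>a\<in>A. measure_pmf.prob M {x. P a x})"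
    using assms(1) by (simp add: measure_UNION_le)
  also have "\<dots> \<le> real (card A) * p"
    using assms(2) by (rule sum_bounded_above)
  finally show ?thesis .
qed

lemma measure_pmf_eq_expectation_of_bool:
  "measure_pmf.prob M {x. P x} = measure_pmf.expectation M (\<lambda>x. of_bool (P x))"
proof -
  have "(\<lambda>x. of_bool (P x)) = (indicator {x. P x} :: _ \<Rightarrow> real)"
    by (auto simp: indicator_def)
  then show ?thesis by simp
qed

lemma expectation_mono:
  fixes f g :: "'a \<Rightarrow> real"
  assumes "finite (set_pmf M)" "\<And>x. x \<in> set_pmf M \<Longrightarrow> f x \<le> g x"
  shows "measure_pmf.expectation M f \<le> measure_pmf.expectation M g"
  using assms
  by (intro integral_mono_AE integrable_measure_pmf_finite) (auto simp: AE_measure_pmf_iff)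

section \<open>Bins\<close>

abbreviation bins :: "nat \<Rightarrow> nat set" where
  "bins r \<equiv> {..<2 ^ r}"

abbreviation uniform_bin :: "nat \<Rightarrow> nat pmf" where
  "uniform_bin r \<equiv> pmf_of_set (bins r)"

lemma finite_set_uniform_bin [simp]: "finite (set_pmf (uniform_bin r))"
  by (simp add: lessThan_empty_iff)

lemma xor_left_self [simp]: "xor a (xor a b) = (b :: nat)"
  by (simp flip: xor.assoc)

lemma xor_eq_iff: "xor a b = c \<longleftrightarrow> a = xor c b" for a b c :: nat
  by (auto simp: xor.assoc)

lemma xor_nat_less_power2:
  fixes a b :: nat
  assumes "a < 2 ^ r" "b < 2 ^ r"
  shows "xor a b < 2 ^ r"
  using assms by (metis take_bit_nat_eq_self_iff take_bit_xor)

lemma inj_on_xor: "inj_on (xor v) A" for v :: nat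
  by (rule inj_on_inverseI[where g = "xor v"]) simp

lemma card_xor_translate [simp]: "card (xor v ` S) = card S" for v :: nat
  by (simp add: card_image inj_on_xor)

lemma card_xor_mem:
  assumes "y \<in> bins r" "E \<subseteq> bins r"
  shows "card {v \<in> bins r. xor v y \<in> E} = card E"
proof -
  have "{v \<in> bins r. xor v y \<in> E} = xor y ` E"
  proof (intro equalityI subsetI)
    fix v assume "v \<in> {v \<in> bins r. xor v y \<in> E}"
    then show "v \<in> xor y ` E"
      by (intro image_eqI[of _ _ "xor v y"]) (auto simp: xor.commute[of v])
  qed (use assms xor_nat_less_power2[of y r] in \<open>auto simp: xor.commute[of _ y]\<close>)
  then show ?thesis by simp
qed

lemma expectation_card_xor_translate_Int:
  assumes "S \<subseteq> bins r" "E \<subseteq> bins r"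
  shows "measure_pmf.expectation (uniform_bin r) (\<lambda>v. real (card (xor v ` S \<inter> E)))
    = real (card S) * real (card E) / 2 ^ r"
proof -
  have "finite S"
    using assms(1) finite_subset by blast
  have "card (xor v ` S \<inter> E) = (\<Sum>y\<in>S. of_bool (xor v y \<in> E))" for v
  proof -
    have "xor v ` S \<inter> E = xor v ` {y \<in> S. xor v y \<in> E}"
      by auto
    then show ?thesis
      using \<open>finite S\<close> by (simp add: Int_def)
  qed
  then have "(\<Sum>v\<in>bins r. card (xor v ` S \<inter> E)) = (\<Sum>y\<in>S. \<Sum>v\<in>bins r. of_bool (xor v y \<in> E))"
    by (simp only: sum.swap[of _ S])
  also have "\<dots> = (\<Sum>y\<in>S. card {v \<in> bins r. xor v y \<in> E})"
    by (simp add: Int_def)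
  also have "\<dots> = (\<Sum>y\<in>S. card E)"
    using assms by (intro sum.cong refl card_xor_mem) auto
  finally show ?thesis
    by (simp add: integral_pmf_of_set lessThan_empty_iff flip: of_nat_sum)
qed

section \<open>Random tables\<close>

definition translate_on :: "'a set \<Rightarrow> nat \<Rightarrow> ('a \<Rightarrow> nat) \<Rightarrow> 'a \<Rightarrow> nat" where
  "translate_on A v f = (\<lambda>x. if x \<in> A then xor v (f x) else f x)"

lemma tab_hash_0 [simp]: "tab_hash 0 T x = 0"
  by (simp add: tab_hash_def)

lemma tab_hash_Suc: "tab_hash (Suc c) T x = xor (tab_hash c T x) (T (c, x ! c))"
  by (simp add: tab_hash_def)

lemma tab_hash_in_bins:
  assumes "T \<in> tables c s r" "x \<in> keys c s"
  shows "tab_hash c T x \<in> bins r"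
proof -
  have "tab_hash k T x \<in> bins r" if "k \<le> c" for k
    using that
  proof (induction k)
    case (Suc k)
    have "T (k, x ! k) \<in> bins r"
      using assms Suc.prems by (auto simp: tables_def keys_def PiE_iff)
    with Suc show ?case
      by (simp add: tab_hash_Suc xor_nat_less_power2)
  qed simp
  then show ?thesis by simp
qed

lemma tab_hash_translate_on:
  assumes "i < c"
  shows "tab_hash c (translate_on {(i, a)} v T) = translate_on {x. x ! i = a} v (tab_hash c T)"
proof
  fix x
  have "tab_hash k (translate_on {(i, a)} v T) x
      = (if i < k \<and> x ! i = a then xor v (tab_hash k T x) else tab_hash k T x)" for k
    by (induction k) (auto simp: tab_hash_Suc translate_on_def less_Suc_eq ac_simps)
  with assms show "tab_hash c (translate_on {(i, a)} v T) x
      = translate_on {x. x ! i = a} v (tab_hash c T) x"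
    by (simp add: translate_on_def)
qed

lemma finite_keys [simp]: "finite (keys c s)"
proof (rule finite_subset)
  show "keys c s \<subseteq> {xs. set xs \<subseteq> {..<s} \<and> length xs = c}"
    by (auto simp: keys_def in_set_conv_nth)
qed (simp add: finite_lists_length_eq)

lemma finite_tables [simp]: "finite (tables c s r)"
  by (auto simp: tables_def intro: finite_PiE)

lemma tables_nonempty [simp]: "tables c s r \<noteq> {}"
  by (auto simp: tables_def PiE_eq_empty_iff lessThan_empty_iff)

lemma bij_betw_translate_on_tables:
  assumes "i < c" "a < s" "v \<in> bins r"
  shows "bij_betw (translate_on {(i, a)} v) (tables c s r) (tables c s r)"
proof -
  have "translate_on {(i, a)} v T \<in> tables c s r" if "T \<in> tables c s r" for T
    using that assms
    by (auto simp: tables_def translate_on_def PiE_iff extensional_def xor_nat_less_power2)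
  then show ?thesis
    by (intro bij_betw_byWitness[where f' = "translate_on {(i, a)} v"])
       (auto simp: translate_on_def fun_eq_iff)
qed

definition hash_pmf :: "nat \<Rightarrow> nat \<Rightarrow> nat \<Rightarrow> (nat list \<Rightarrow> nat) pmf" where
  "hash_pmf c s r = map_pmf (tab_hash c) (table_pmf c s r)"

lemma finite_set_hash_pmf [simp]: "finite (set_pmf (hash_pmf c s r))"
  by (simp add: hash_pmf_def table_pmf_def)

lemma hash_in_bins:
  assumes "h \<in> set_pmf (hash_pmf c s r)" "x \<in> keys c s"
  shows "h x \<in> bins r"
  using assms tab_hash_in_bins by (force simp: hash_pmf_def table_pmf_def)

lemma map_pmf_translate_on_hash_pmf:
  assumes "i < c" "a < s" "v \<in> bins r"
  shows "map_pmf (translate_on {x. x ! i = a} v) (hash_pmf c s r) = hash_pmf c s r"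
proof -
  have "map_pmf (translate_on {x. x ! i = a} v) (hash_pmf c s r)
      = map_pmf (tab_hash c) (map_pmf (translate_on {(i, a)} v) (table_pmf c s r))"
    using assms(1) by (simp add: hash_pmf_def pmf.map_comp o_def tab_hash_translate_on)
  also have "map_pmf (translate_on {(i, a)} v) (table_pmf c s r) = table_pmf c s r"
    unfolding table_pmf_def using assms
    by (intro map_pmf_of_set_bij_betw bij_betw_translate_on_tables) auto
  finally show ?thesis
    by (simp add: hash_pmf_def)
qed

lemma expectation_hash_pmf_translate_on:
  fixes F :: "(nat list \<Rightarrow> nat) \<Rightarrow> real"
  assumes "i < c" "a < s"
  shows "measure_pmf.expectation (hash_pmf c s r) F
    = measure_pmf.expectation (hash_pmf c s r)
        (\<lambda>h. measure_pmf.expectation (uniform_bin r) (\<lambda>v. F (translate_on {x. x ! i = a} v h)))"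
proof -
  let ?E = "measure_pmf.expectation (hash_pmf c s r)"
  have "?E (\<lambda>h. F (translate_on {x. x ! i = a} v h)) = ?E F" if "v \<in> bins r" for v
    using integral_map_pmf[of "translate_on {x. x ! i = a} v" "hash_pmf c s r" F]
    by (simp only: map_pmf_translate_on_hash_pmf[OF assms that])
  moreover have "integrable (measure_pmf (hash_pmf c s r)) G" for G :: "_ \<Rightarrow> real"
    by (simp add: integrable_measure_pmf_finite)
  ultimately show ?thesis
    by (simp add: integral_pmf_of_set lessThan_empty_iff)
qed

section \<open>Loads\<close>

definition distinguished :: "nat \<Rightarrow> 'a list set \<Rightarrow> bool" where
  "distinguished c X \<longleftrightarrow> (\<exists>i<c. inj_on (\<lambda>x. x ! i) X)"

definition spread :: "nat \<Rightarrow> ('a \<Rightarrow> 'b) \<Rightarrow> 'a set \<Rightarrow> bool" where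
  "spread d f A \<longleftrightarrow> card A \<le> d * card (f ` A)"

lemma prob_hash_eq_insert_le:
  assumes "i < c" "x \<in> keys c s" and distinct: "\<And>z. z \<in> B \<Longrightarrow> z ! i \<noteq> x ! i"
  shows "measure_pmf.prob (hash_pmf c s r) {h. \<forall>z\<in>insert x B. h z = y z}
    \<le> measure_pmf.prob (hash_pmf c s r) {h. \<forall>z\<in>B. h z = y z} / 2 ^ r"
proof -
  let ?eq = "\<lambda>B h. \<forall>z\<in>B. h z = y z"
  have "x ! i < s"
    using assms(1,2) by (simp add: keys_def)
  have "measure_pmf.expectation (uniform_bin r)
      (\<lambda>v. of_bool (?eq (insert x B) (translate_on {z. z ! i = x ! i} v h)))
      \<le> (of_bool (?eq B h) / 2 ^ r :: real)" for h
  proof -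
    have "(\<Sum>v\<in>bins r. of_bool (?eq (insert x B) (translate_on {z. z ! i = x ! i} v h)))
        = (\<Sum>v\<in>bins r. of_bool (?eq B h) * of_bool (xor v (h x) = y x) :: real)"
      using distinct by (intro sum.cong refl) (auto simp: translate_on_def)
    also have "\<dots> = of_bool (?eq B h) * real (card {v \<in> bins r. xor v (h x) = y x})"
      by (simp add: Int_def flip: sum_distrib_left)
    also have "\<dots> \<le> of_bool (?eq B h) * 1"
    proof (rule mult_left_mono)
      have "card {v \<in> bins r. xor v (h x) = y x} \<le> card {xor (y x) (h x)}"
        by (intro card_mono) (auto simp: xor_eq_iff)
      then show "real (card {v \<in> bins r. xor v (h x) = y x}) \<le> 1"
        by simp
    qed simp
    finally show ?thesis
      by (simp add: integral_pmf_of_set lessThan_empty_iff divide_right_mono del: of_bool_eq_iff)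
  qed
  then show ?thesis
    unfolding measure_pmf_eq_expectation_of_bool integral_divide_zero[symmetric]
    by (subst expectation_hash_pmf_translate_on[OF \<open>i < c\<close> \<open>x ! i < s\<close>])
       (intro expectation_mono finite_set_hash_pmf)
qed

lemma prob_hash_eq_le:
  assumes "B \<subseteq> keys c s" "distinguished c B"
  shows "measure_pmf.prob (hash_pmf c s r) {h. \<forall>x\<in>B. h x = y x} \<le> 1 / (2 ^ r) ^ card B"
proof -
  obtain i where "i < c" "inj_on (\<lambda>x. x ! i) B"
    using assms(2) by (auto simp: distinguished_def)
  from finite_subset[OF assms(1) finite_keys] assms(1) this show ?thesis
  proof (induction B rule: finite_induct)
    case (insert x B)
    let ?prob = "\<lambda>B. measure_pmf.prob (hash_pmf c s r) {h. \<forall>x\<in>B. h x = y x}"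
    have "?prob (insert x B) \<le> ?prob B / 2 ^ r"
      using insert.prems insert.hyps by (intro prob_hash_eq_insert_le) (auto simp: image_iff)
    also have "\<dots> \<le> 1 / (2 ^ r) ^ card B / 2 ^ r"
      using insert by (intro divide_right_mono) auto
    finally show ?case
      using insert.hyps by (simp add: field_simps)
  qed simp
qed

lemma prob_hash_constant_le:
  assumes "B \<subseteq> keys c s" "distinguished c B" "card B = Suc k"
  shows "measure_pmf.prob (hash_pmf c s r) {h. \<exists>y. \<forall>x\<in>B. h x = y} \<le> 1 / (2 ^ r) ^ k"
proof -
  obtain x where "x \<in> B"
    using assms(3) by fastforce
  have "measure_pmf.prob (hash_pmf c s r) {h. \<exists>y. \<forall>x\<in>B. h x = y}
      \<le> measure_pmf.prob (hash_pmf c s r) {h. \<exists>y\<in>bins r. \<forall>x\<in>B. h x = y}"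
  proof (rule measure_pmf_Collect_mono)
    fix h assume "h \<in> set_pmf (hash_pmf c s r)" and collapse: "\<exists>y. \<forall>x\<in>B. h x = y"
    then have "h x \<in> bins r"
      using \<open>x \<in> B\<close> assms(1) by (intro hash_in_bins[of h c s r x]) auto
    moreover have "\<forall>z\<in>B. h z = h x"
      using collapse \<open>x \<in> B\<close> by auto
    ultimately show "\<exists>y\<in>bins r. \<forall>x\<in>B. h x = y" by blast
  qed
  also have "\<dots> \<le> real (card (bins r)) * (1 / (2 ^ r) ^ card B)"
    using assms by (intro measure_pmf_Bex_le prob_hash_eq_le) auto
  finally show ?thesis
    using assms(3) by simp
qed

lemma card_le_prod_card_nth_image:
  assumes "finite X" "\<And>x. x \<in> X \<Longrightarrow> length x = c"
  shows "card X \<le> (\<Prod>i<c. card ((\<lambda>x. x ! i) ` X))"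
proof -
  let ?f = "\<lambda>x. restrict (\<lambda>i. x ! i) {..<c}"
  have "inj_on ?f X"
  proof (rule inj_onI)
    fix x y assume agree: "x \<in> X" "y \<in> X" "?f x = ?f y"
    have "x ! i = y ! i" if "i < c" for i
      using fun_cong[OF agree(3), of i] that by simp
    then show "x = y"
      using agree assms(2) by (auto intro: nth_equalityI)
  qed
  moreover have "?f ` X \<subseteq> Pi\<^sub>E {..<c} (\<lambda>i. (\<lambda>x. x ! i) ` X)"
    by (auto split: if_splits)
  ultimately have "card X \<le> card (Pi\<^sub>E {..<c} (\<lambda>i. (\<lambda>x. x ! i) ` X))"
    using assms(1) by (intro card_inj_on_le) (auto intro: finite_PiE)
  then show ?thesis
    by (simp add: card_PiE)
qed

lemma ex_distinguished_subset:
  assumes "finite X" "\<And>x. x \<in> X \<Longrightarrow> length x = c" "card X > k ^ c"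
  obtains B where "B \<subseteq> X" "card B = Suc k" "distinguished c B"
proof -
  have "\<exists>i<c. Suc k \<le> card ((\<lambda>x. x ! i) ` X)"
  proof (rule ccontr)
    assume "\<not> ?thesis"
    then have "(\<Prod>i<c. card ((\<lambda>x. x ! i) ` X)) \<le> (\<Prod>i<c. k)"
      by (intro prod_mono) auto
    with card_le_prod_card_nth_image[of X c] assms show False by simp
  qed
  then obtain i S where many_values: "i < c" "S \<subseteq> (\<lambda>x. x ! i) ` X" "card S = Suc k"
    by (meson obtain_subset_with_card_n)
  then obtain B where "B \<subseteq> X" "inj_on (\<lambda>x. x ! i) B" "S = (\<lambda>x. x ! i) ` B"
    unfolding subset_image_inj by blast
  with many_values show ?thesis
    by (intro that[of B]) (auto simp: distinguished_def card_image)
qed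

lemma ex_fiber_gt_if_not_spread:
  assumes "finite A" "\<not> spread d f A"
  shows "\<exists>y. d < card {x \<in> A. f x = y}"
proof (rule ccontr)
  assume "\<not> ?thesis"
  then have fibers_le: "card {x \<in> A. f x = y} \<le> d" for y
    by (simp add: not_less)
  have "card A = (\<Sum>y\<in>f ` A. card {x \<in> A. f x = y})"
    using sum.image_gen[OF assms(1), of "\<lambda>_. 1 :: nat" f] by simp
  also have "\<dots> \<le> (\<Sum>y\<in>f ` A. d)"
    using fibers_le by (rule sum_mono)
  finally show False
    using assms(2) by (simp add: spread_def mult.commute)
qed

lemma card_subsets_le_power:
  assumes "finite A"
  shows "card {B. B \<subseteq> A \<and> card B = k} \<le> card A ^ k"
  using assms by (cases "k \<le> card A") (simp_all add: n_subsets binomial_le_pow binomial_eq_0)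

lemma prob_not_spread_le:
  assumes A_keys: "A \<subseteq> keys c s" and card_le: "real (card A) \<le> M"
  shows "measure_pmf.prob (hash_pmf c s r) {h. \<not> spread (k ^ c) h A} \<le> M ^ Suc k / (2 ^ r) ^ k"
proof -
  let ?\<B> = "{B. B \<subseteq> A \<and> card B = Suc k \<and> distinguished c B}"
  have "finite A"
    using A_keys finite_keys by (rule finite_subset)
  then have "finite ?\<B>"
    by (rule rev_finite_subset[OF finite_Pow_iff[THEN iffD2]]) auto
  have "measure_pmf.prob (hash_pmf c s r) {h. \<not> spread (k ^ c) h A}
      \<le> measure_pmf.prob (hash_pmf c s r) {h. \<exists>B\<in>?\<B>. \<exists>y. \<forall>x\<in>B. h x = y}"
  proof (rule measure_pmf_Collect_mono)
    fix h assume "\<not> spread (k ^ c) h A"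
    then obtain y where crowded_bin: "k ^ c < card {x \<in> A. h x = y}"
      using ex_fiber_gt_if_not_spread[OF \<open>finite A\<close>] by blast
    have "finite {x \<in> A. h x = y}" "\<And>x. x \<in> {x \<in> A. h x = y} \<Longrightarrow> length x = c"
      using \<open>finite A\<close> A_keys by (auto simp: keys_def)
    then obtain B where "B \<subseteq> {x \<in> A. h x = y}" "card B = Suc k" "distinguished c B"
      using ex_distinguished_subset[OF _ _ crowded_bin] by blast
    then show "\<exists>B\<in>?\<B>. \<exists>y. \<forall>x\<in>B. h x = y"
      by (intro bexI[of _ B] exI[of _ y]) auto
  qed
  also have "\<dots> \<le> real (card ?\<B>) * (1 / (2 ^ r) ^ k)"
    using A_keys \<open>finite ?\<B>\<close> by (intro measure_pmf_Bex_le prob_hash_constant_le) auto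
  also have "\<dots> \<le> M ^ Suc k * (1 / (2 ^ r) ^ k)"
  proof (rule mult_right_mono)
    have "card ?\<B> \<le> card {B. B \<subseteq> A \<and> card B = Suc k}"
      using \<open>finite A\<close> by (intro card_mono) auto
    also have "\<dots> \<le> card A ^ Suc k"
      using \<open>finite A\<close> by (rule card_subsets_le_power)
    finally have "real (card ?\<B>) \<le> real (card A) ^ Suc k"
      by (metis of_nat_mono of_nat_power)
    also have "\<dots> \<le> M ^ Suc k"
      using card_le by (intro power_mono) auto
    finally show "real (card ?\<B>) \<le> M ^ Suc k" .
  qed simp
  finally show ?thesis by simp
qed

section \<open>Peeling\<close>

text \<open>The character shared by \<open>G\<close> does not occur in \<open>X\<close>, so changing its table entry translates the
  hashes of \<open>G\<close> and leaves those of \<open>X\<close> alone.\<close>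

inductive peeling :: "nat \<Rightarrow> real \<Rightarrow> 'a list set \<Rightarrow> 'a list set set \<Rightarrow> bool"
  for c :: nat and M :: real
where
  empty: "peeling c M {} {}"
| insert: "peeling c M (G \<union> X) (insert G \<G>)"
    if "peeling c M X \<G>" "i < c" "\<forall>x\<in>G. x ! i = a" "\<forall>x\<in>X. x ! i \<noteq> a"
      "finite G" "G \<noteq> {}" "real (card G) \<le> M"

lemma peeling_finite: "peeling c M X \<G> \<Longrightarrow> finite X \<and> finite \<G>"
  by (induction rule: peeling.induct) auto

lemma peeling_group: "peeling c M X \<G> \<Longrightarrow> G \<in> \<G> \<Longrightarrow> G \<subseteq> X \<and> real (card G) \<le> M"
  by (induction rule: peeling.induct) auto

lemma peeling_card_le: "peeling c M X \<G> \<Longrightarrow> card \<G> \<le> card X"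
proof (induction rule: peeling.induct)
  case (insert X \<G> i G a)
  have "card (insert G \<G>) \<le> Suc (card \<G>)"
    by (rule card_insert_le_m1) auto
  also have "\<dots> \<le> card G + card X"
  proof -
    have "card G > 0"
      using insert.hyps by (simp add: card_gt_0_iff)
    with insert.IH show ?thesis by linarith
  qed
  also have "\<dots> = card (G \<union> X)"
    using insert.hyps peeling_finite[OF insert.hyps(1)]
    by (intro card_Un_disjoint[symmetric]) auto
  finally show ?case .
qed simp

definition agreeing :: "nat \<Rightarrow> 'a \<Rightarrow> 'a list set \<Rightarrow> 'a list set" where
  "agreeing i a X = {x \<in> X. x ! i = a}"

lemma ex_small_agreeing_class:
  assumes X_lists: "finite X" "X \<noteq> {}" "\<And>x. x \<in> X \<Longrightarrow> length x = c" and "c \<ge> 1"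
  obtains i x where "i < c" "x \<in> X" "card (agreeing i (x ! i) X) ^ c \<le> card X ^ (c - 1)"
proof -
  let ?values = "\<lambda>i. (\<lambda>x. x ! i) ` X"
  have "finite ({..<c} \<times> X)" "{..<c} \<times> X \<noteq> {}"
    using X_lists \<open>c \<ge> 1\<close> by (auto simp: lessThan_empty_iff)
  then obtain p where "is_arg_min (\<lambda>(i, x). card (agreeing i (x ! i) X)) (\<lambda>p. p \<in> {..<c} \<times> X) p"
    using ex_is_arg_min_if_finite by blast
  then obtain i x where position: "i < c" "x \<in> X"
    and minimal: "\<forall>j<c. \<forall>z\<in>X. card (agreeing i (x ! i) X) \<le> card (agreeing j (z ! j) X)"
    unfolding is_arg_min_linorder by auto
  define g where "g = card (agreeing i (x ! i) X)"
  have "card (?values j) * g \<le> card X" if "j < c" for j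
  proof -
    have "card (?values j) * g = (\<Sum>a\<in>?values j. g)"
      by simp
    also have "\<dots> \<le> (\<Sum>a\<in>?values j. card {z \<in> X. z ! j = a})"
      using minimal that unfolding g_def agreeing_def by (intro sum_mono) force
    also have "\<dots> = card X"
      using sum.image_gen[OF X_lists(1), of "\<lambda>_. 1 :: nat" "\<lambda>z. z ! j"] by simp
    finally show ?thesis .
  qed
  then have "(\<Prod>j<c. card (?values j) * g) \<le> (\<Prod>j<c. card X)"
    by (intro prod_mono) auto
  then have "(\<Prod>j<c. card (?values j)) * g ^ c \<le> card X ^ c"
    by (simp add: prod.distrib)
  moreover have "card X * g ^ c \<le> (\<Prod>j<c. card (?values j)) * g ^ c"
    using card_le_prod_card_nth_image[OF X_lists(1,3)] by (rule mult_le_mono1)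
  moreover have "card X ^ c = card X * card X ^ (c - 1)"
    using \<open>c \<ge> 1\<close> by (cases c) auto
  ultimately have "card X * g ^ c \<le> card X * card X ^ (c - 1)"
    by linarith
  then have "g ^ c \<le> card X ^ (c - 1)"
    using X_lists by (simp add: card_gt_0_iff)
  with position show ?thesis
    unfolding g_def by (rule that)
qed

lemma le_powr_of_power_le:
  fixes g m c :: nat
  assumes "g ^ c \<le> m ^ (c - 1)" "c \<ge> 1" "m \<ge> 1"
  shows "real g \<le> real m powr (1 - 1 / real c)"
proof -
  have "real g ^ c \<le> real m ^ (c - 1)"
    using assms(1) by (metis of_nat_le_iff of_nat_power)
  also have "\<dots> = real m powr real (c - 1)"
    using assms by (subst powr_realpow) auto
  also have "real (c - 1) = (1 - 1 / real c) * real c"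
    using assms by (simp add: field_simps of_nat_diff)
  also have "real m powr \<dots> = (real m powr (1 - 1 / real c)) ^ c"
    using assms by (simp add: powr_powr[symmetric] powr_realpow)
  finally show ?thesis
    using assms by (subst (asm) power_mono_iff) auto
qed

lemma ex_peeling:
  assumes "finite X" "\<And>x. x \<in> X \<Longrightarrow> length x = c" "c \<ge> 1"
    and "real (card X) powr (1 - 1 / real c) \<le> M"
  shows "\<exists>\<G>. peeling c M X \<G>"
  using assms
proof (induction "card X" arbitrary: X rule: less_induct)
  case (less X)
  show ?case
  proof (cases "X = {}")
    case True
    then show ?thesis using peeling.empty by blast
  next
    case False
    obtain i x where small_class: "i < c" "x \<in> X"
        "card (agreeing i (x ! i) X) ^ c \<le> card X ^ (c - 1)"
      using ex_small_agreeing_class[OF less.prems(1) False less.prems(2,3)] .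
    define G where "G = agreeing i (x ! i) X"
    have group: "G \<subseteq> X" "x \<in> G" "finite G"
      using small_class less.prems(1) by (auto simp: G_def agreeing_def)
    have "card X \<ge> 1"
      using False less.prems(1) by (simp add: Suc_le_eq card_gt_0_iff)
    then have "real (card G) \<le> real (card X) powr (1 - 1 / real c)"
      using small_class(3) less.prems(3) unfolding G_def by (intro le_powr_of_power_le)
    with less.prems(4) have "real (card G) \<le> M" by simp
    have "card (X - G) < card X"
      using group less.prems(1) by (intro psubset_card_mono) auto
    moreover from this have "real (card (X - G)) powr (1 - 1 / real c) \<le> M"
      using less.prems(3,4) powr_mono2[of "1 - 1 / real c" "real (card (X - G))" "real (card X)"]
      by simp
    ultimately obtain \<G> where "peeling c M (X - G) \<G>"
      using less.hyps[of "X - G"] less.prems by auto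
    then have "peeling c M (G \<union> (X - G)) (insert G \<G>)"
      using small_class(1) group \<open>real (card G) \<le> M\<close>
      by (intro peeling.insert[where i = i and a = "x ! i"]) (auto simp: G_def agreeing_def)
    moreover have "G \<union> (X - G) = X"
      using group by auto
    ultimately show ?thesis by auto
  qed
qed

section \<open>Moments of the number of empty bins\<close>

definition empty_bins :: "nat \<Rightarrow> ('a \<Rightarrow> nat) \<Rightarrow> 'a set \<Rightarrow> nat set" where
  "empty_bins r f X = bins r - f ` X"

lemma card_empty_bins:
  assumes "h \<in> set_pmf (hash_pmf c s r)" "X \<subseteq> keys c s"
  shows "real (card (empty_bins r h X)) = 2 ^ r - real (card (h ` X))"
proof -
  have "h ` X \<subseteq> bins r"
    using assms hash_in_bins by blast
  then show ?thesis
    using card_mono[of "bins r" "h ` X"]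
    by (simp add: empty_bins_def card_Diff_subset finite_subset of_nat_diff)
qed

lemma exp_minus_le_linear:
  fixes z :: real
  assumes "0 \<le> z" "z \<le> 1"
  shows "exp (- z) \<le> 1 - z / 2"
proof -
  have "z * z \<le> 1 * z"
    using assms by (intro mult_right_mono) auto
  then have "1 \<le> (1 - z / 2) * (1 + z)"
    by (simp add: algebra_simps)
  also have "\<dots> \<le> (1 - z / 2) * exp z"
    using assms exp_ge_add_one_self by (intro mult_left_mono) auto
  finally show ?thesis
    by (simp add: exp_minus field_simps)
qed

lemma powr_diff_le_linear:
  fixes L Y t :: real
  assumes "0 \<le> t" "0 \<le> Y" "Y \<le> L" "t * Y \<le> L"
  shows "(L - Y) powr t \<le> L powr t * (1 - t * Y / (2 * L))"
proof (cases "L = 0")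
  case False
  then have "L > 0"
    using assms by linarith
  have "(1 - Y / L) powr t \<le> exp (- (Y / L)) powr t"
    using assms \<open>L > 0\<close> exp_ge_add_one_self[of "- (Y / L)"] by (intro powr_mono2) auto
  also have "\<dots> = exp (- (t * Y / L))"
    by (simp add: exp_powr_real mult.commute)
  also have "\<dots> \<le> 1 - t * Y / L / 2"
    using assms \<open>L > 0\<close> by (intro exp_minus_le_linear) auto
  finally have "L powr t * (1 - Y / L) powr t \<le> L powr t * (1 - t * Y / (2 * L))"
    by (intro mult_left_mono) (auto simp: mult.commute)
  moreover have "L - Y = L * (1 - Y / L)"
    using \<open>L > 0\<close> by (simp add: field_simps)
  then have "(L - Y) powr t = L powr t * (1 - Y / L) powr t"
    using assms \<open>L > 0\<close> powr_mult[of L "1 - Y / L" t] by simp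
  ultimately show ?thesis by simp
qed (use assms in simp)

lemma powr_card_Diff_le:
  fixes t :: real
  assumes finite_sets: "finite S" "finite E"
    and exponent: "0 \<le> t" "t \<le> 1 \<or> t * real (card S) \<le> real (card E)"
  shows "real (card (E - S)) powr t
    \<le> real (card E) powr t * (1 - t * real (card (S \<inter> E)) / (2 * real (card E)))"
proof -
  have covered_le: "real (card (S \<inter> E)) \<le> real (card E)" "real (card (S \<inter> E)) \<le> real (card S)"
    using finite_sets by (auto intro: card_mono)
  have "t * real (card (S \<inter> E)) \<le> real (card E)"
    using exponent(2)
  proof
    assume "t \<le> 1"
    then have "t * real (card (S \<inter> E)) \<le> 1 * real (card (S \<inter> E))"
      by (rule mult_right_mono) simp
    with covered_le(1) show ?thesis by simp
  next
    assume "t * real (card S) \<le> real (card E)"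
    with mult_left_mono[OF covered_le(2) exponent(1)] show ?thesis by linarith
  qed
  moreover have "real (card (E - S)) = real (card E) - real (card (S \<inter> E))"
    using finite_sets covered_le(1) by (simp add: card_Diff_subset_Int Int_commute of_nat_diff)
  ultimately show ?thesis
    using powr_diff_le_linear[of t "real (card (S \<inter> E))" "real (card E)"] covered_le(1) exponent(1)
    by simp
qed

lemma expectation_powr_card_Diff_xor_le:
  fixes t :: real
  assumes S_bins: "S \<subseteq> bins r" and E_bins: "E \<subseteq> bins r"
    and exponent: "0 \<le> t" "t \<le> 1 \<or> t * real (card S) \<le> real (card E)"
  shows "measure_pmf.expectation (uniform_bin r) (\<lambda>v. real (card (E - xor v ` S)) powr t)
    \<le> real (card E) powr t * exp (- t * real (card S) / (2 * 2 ^ r))"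
proof (cases "E = {}")
  case False
  let ?E = "measure_pmf.expectation (uniform_bin r)"
  let ?covered = "\<lambda>v. real (card (xor v ` S \<inter> E))"
  have finite_sets: "finite S" "finite E"
    using S_bins E_bins finite_subset by blast+
  then have "real (card E) > 0"
    using False by (simp add: card_gt_0_iff)
  have "?E (\<lambda>v. real (card (E - xor v ` S)) powr t)
      \<le> ?E (\<lambda>v. real (card E) powr t * (1 - t * ?covered v / (2 * real (card E))))"
    using finite_sets exponent by (intro expectation_mono powr_card_Diff_le) auto
  also have "\<dots> = real (card E) powr t * (1 - t * ?E ?covered / (2 * real (card E)))"
    by (simp add: integrable_measure_pmf_finite)
  also have "?E ?covered = real (card S) * real (card E) / 2 ^ r"
    using S_bins E_bins by (rule expectation_card_xor_translate_Int)
  also have "1 - t * (real (card S) * real (card E) / 2 ^ r) / (2 * real (card E))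
      = 1 + (- t * real (card S) / (2 * 2 ^ r))"
    using \<open>real (card E) > 0\<close> by (simp add: field_simps)
  also have "real (card E) powr t * \<dots>
      \<le> real (card E) powr t * exp (- t * real (card S) / (2 * 2 ^ r))"
    by (intro mult_left_mono exp_ge_add_one_self) auto
  finally show ?thesis .
qed simp

text \<open>The cutoff discards the functions for which a further group need not shrink the moment: a
  group that is not spread occupies too few bins, and below \<open>\<theta>\<close> the exponent \<open>t\<close> is too large for
  the linear approximation of the \<open>t\<close>-th power.\<close>

definition potential ::
    "nat \<Rightarrow> nat \<Rightarrow> real \<Rightarrow> real \<Rightarrow> 'a set set \<Rightarrow> 'a set \<Rightarrow> ('a \<Rightarrow> nat) \<Rightarrow> real" where
  "potential r d \<theta> t \<G> X f =
    (if \<theta> \<le> real (card (empty_bins r f X)) \<and> (\<forall>G\<in>\<G>. spread d f G)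
     then real (card (empty_bins r f X)) powr t else 0)"

lemma potential_nonneg: "0 \<le> potential r d \<theta> t \<G> X f"
  by (simp add: potential_def)

lemma image_translate_on_disjoint: "A \<inter> X = {} \<Longrightarrow> translate_on A v f ` X = f ` X"
  by (intro image_cong) (auto simp: translate_on_def)

lemma image_translate_on_subset: "G \<subseteq> A \<Longrightarrow> translate_on A v f ` G = xor v ` f ` G"
  by (auto simp: translate_on_def image_image intro!: image_cong)

lemma empty_bins_translate_on:
  assumes "G \<subseteq> A" "A \<inter> X = {}"
  shows "empty_bins r (translate_on A v f) (G \<union> X) = empty_bins r f X - xor v ` f ` G"
  unfolding empty_bins_def image_Un image_translate_on_disjoint[OF assms(2)]
    image_translate_on_subset[OF assms(1)] by blast

lemma spread_translate_on_disjoint: "A \<inter> X = {} \<Longrightarrow> spread d (translate_on A v f) X \<longleftrightarrow> spread d f X"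
  by (simp add: spread_def image_translate_on_disjoint)

lemma spread_translate_on_subset: "G \<subseteq> A \<Longrightarrow> spread d (translate_on A v f) G \<longleftrightarrow> spread d f G"
  by (simp add: spread_def image_translate_on_subset)

lemma potential_insert_translate_on:
  assumes translated: "G \<subseteq> A" "A \<inter> X = {}" and groups: "\<And>H. H \<in> \<G> \<Longrightarrow> H \<subseteq> X"
  shows "potential r d \<theta> t (insert G \<G>) (G \<union> X) (translate_on A v f) =
    (if \<theta> \<le> real (card (empty_bins r f X - xor v ` f ` G)) \<and> spread d f G \<and> (\<forall>H\<in>\<G>. spread d f H)
     then real (card (empty_bins r f X - xor v ` f ` G)) powr t else 0)"
proof -
  have "\<forall>H\<in>\<G>. A \<inter> H = {}"
    using groups translated(2) by blast
  then show ?thesis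
    by (simp add: potential_def empty_bins_translate_on[OF translated]
        spread_translate_on_subset[OF translated(1)] spread_translate_on_disjoint)
qed

lemma expectation_potential_translate_on_le:
  assumes translated: "G \<subseteq> A" "A \<inter> X = {}" and groups: "\<And>H. H \<in> \<G> \<Longrightarrow> H \<subseteq> X"
    and group: "finite G" "real (card G) \<le> M" "f ` G \<subseteq> bins r"
    and "0 \<le> t" "d > 0" and small: "t \<le> 1 \<or> t * M \<le> \<theta>"
  shows "measure_pmf.expectation (uniform_bin r)
      (\<lambda>v. potential r d \<theta> t (insert G \<G>) (G \<union> X) (translate_on A v f))
    \<le> exp (- t * real (card G) / (2 * real d * 2 ^ r)) * potential r d \<theta> t \<G> X f"
proof -
  let ?E = "measure_pmf.expectation (uniform_bin r)"
  let ?potential = "\<lambda>v. potential r d \<theta> t (insert G \<G>) (G \<union> X) (translate_on A v f)"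
  let ?L = "real (card (empty_bins r f X))"
  have potential_eq: "?potential v =
      (if \<theta> \<le> real (card (empty_bins r f X - xor v ` f ` G)) \<and> spread d f G \<and> (\<forall>H\<in>\<G>. spread d f H)
       then real (card (empty_bins r f X - xor v ` f ` G)) powr t else 0)" for v
    by (rule potential_insert_translate_on[OF translated groups])
  show ?thesis
  proof (cases "\<theta> \<le> ?L \<and> spread d f G \<and> (\<forall>H\<in>\<G>. spread d f H)")
    case True
    have "?E ?potential \<le> ?E (\<lambda>v. real (card (empty_bins r f X - xor v ` f ` G)) powr t)"
      unfolding potential_eq by (intro expectation_mono) auto
    also have "\<dots> \<le> ?L powr t * exp (- t * real (card (f ` G)) / (2 * 2 ^ r))"
    proof (rule expectation_powr_card_Diff_xor_le)
      have "real (card (f ` G)) \<le> M"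
        using card_image_le[OF group(1), of f] group(2) by linarith
      with mult_left_mono[OF this \<open>0 \<le> t\<close>] show "t \<le> 1 \<or> t * real (card (f ` G)) \<le> ?L"
        using small True by linarith
    qed (use group \<open>0 \<le> t\<close> in \<open>auto simp: empty_bins_def\<close>)
    also have "\<dots> \<le> ?L powr t * exp (- t * real (card G) / (2 * real d * 2 ^ r))"
    proof -
      have "real (card G) \<le> real d * real (card (f ` G))"
        using True by (metis of_nat_le_iff of_nat_mult spread_def)
      from mult_left_mono[OF this \<open>0 \<le> t\<close>] show ?thesis
        using \<open>d > 0\<close> by (intro mult_left_mono) (auto simp: field_simps)
    qed
    finally show ?thesis
      using True by (simp add: potential_def[of r d \<theta> t \<G>] mult.commute)
  next
    case False
    have "card (empty_bins r f X - xor v ` f ` G) \<le> card (empty_bins r f X)" for v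
      by (intro card_mono) (auto simp: empty_bins_def)
    then have "?potential v = 0" for v
      using False order.trans[of \<theta>] unfolding potential_eq by (metis of_nat_mono)
    then show ?thesis
      by (simp add: potential_def)
  qed
qed

lemma expectation_potential_le:
  assumes "peeling c M X \<G>" "X \<subseteq> keys c s" and "0 \<le> t" "d > 0" "t \<le> 1 \<or> t * M \<le> \<theta>"
  shows "measure_pmf.expectation (hash_pmf c s r) (potential r d \<theta> t \<G> X)
    \<le> (2 ^ r) powr t * exp (- t * real (card X) / (2 * real d * 2 ^ r))"
  using assms(1,2)
proof (induction rule: peeling.induct)
  case (insert X \<G> i G a)
  let ?E = "measure_pmf.expectation (hash_pmf c s r)"
  let ?e = "\<lambda>m. exp (- t * real m / (2 * real d * 2 ^ r))"
  obtain x where "x \<in> G"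
    using insert.hyps(6) by blast
  then have "a < s"
    using insert.hyps(2,3) insert.prems by (force simp: keys_def)
  have "?E (potential r d \<theta> t (insert G \<G>) (G \<union> X))
      \<le> ?E (\<lambda>h. ?e (card G) * potential r d \<theta> t \<G> X h)"
    unfolding expectation_hash_pmf_translate_on[OF insert.hyps(2) \<open>a < s\<close>,
        of r "potential r d \<theta> t (insert G \<G>) (G \<union> X)"]
  proof (intro expectation_mono expectation_potential_translate_on_le)
    show "h ` G \<subseteq> bins r" if "h \<in> set_pmf (hash_pmf c s r)" for h
      using hash_in_bins[OF that] insert.prems by blast
    show "H \<subseteq> X" if "H \<in> \<G>" for H
      using peeling_group[OF insert.hyps(1) that] by simp
  qed (use insert.hyps assms(3-5) in auto)
  also have "\<dots> = ?e (card G) * ?E (potential r d \<theta> t \<G> X)"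
    by simp
  also have "\<dots> \<le> ?e (card G) * ((2 ^ r) powr t * ?e (card X))"
    using insert.IH insert.prems by (intro mult_left_mono) auto
  also have "\<dots> = (2 ^ r) powr t * ?e (card G + card X)"
    by (simp add: ring_distribs add_divide_distrib diff_divide_distrib flip: exp_add)
  also have "card G + card X = card (G \<union> X)"
    using insert.hyps peeling_finite[OF insert.hyps(1)]
    by (intro card_Un_disjoint[symmetric]) auto
  finally show ?case .
qed (simp add: potential_def[abs_def] empty_bins_def cong: if_cong)

lemma prob_empty_bins_ge_le:
  assumes X_keys: "X \<subseteq> keys c s" and "c \<ge> 1" "\<theta> > 0" "t \<ge> 0" "k > 0"
    and exponent: "t \<le> 1 \<or> t * M \<le> \<theta>" and group_size: "real (card X) powr (1 - 1 / real c) \<le> M"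
  shows "measure_pmf.prob (hash_pmf c s r) {h. \<theta> \<le> real (card (empty_bins r h X))}
     \<le> real (card X) * (M ^ Suc k / (2 ^ r) ^ k)
       + (2 ^ r / \<theta>) powr t * exp (- t * real (card X) / (2 * real (k ^ c) * 2 ^ r))"
    (is "?prob \<le> _ + ?tail")
proof -
  let ?P = "\<lambda>Q. measure_pmf.prob (hash_pmf c s r) {h. Q h}"
  have "finite X" "\<And>x. x \<in> X \<Longrightarrow> length x = c"
    using X_keys finite_subset[OF X_keys finite_keys] by (auto simp: keys_def)
  then obtain \<G> where peeling: "peeling c M X \<G>"
    using ex_peeling[of X c M] \<open>c \<ge> 1\<close> group_size by blast
  have "0 \<le> M"
    using group_size powr_ge_zero order.trans by blast
  have "?P (\<lambda>h. \<exists>G\<in>\<G>. \<not> spread (k ^ c) h G) \<le> real (card \<G>) * (M ^ Suc k / (2 ^ r) ^ k)"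
    using X_keys peeling_finite[OF peeling] peeling_group[OF peeling]
    by (intro measure_pmf_Bex_le prob_not_spread_le) auto
  also have "\<dots> \<le> real (card X) * (M ^ Suc k / (2 ^ r) ^ k)"
    using peeling_card_le[OF peeling] \<open>0 \<le> M\<close> by (intro mult_right_mono) auto
  finally have crowded: "?P (\<lambda>h. \<exists>G\<in>\<G>. \<not> spread (k ^ c) h G) \<le> \<dots>" .
  have "?P (\<lambda>h. \<theta> powr t \<le> potential r (k ^ c) \<theta> t \<G> X h)
      \<le> measure_pmf.expectation (hash_pmf c s r) (potential r (k ^ c) \<theta> t \<G> X) / \<theta> powr t"
    using integral_Markov_inequality_measure[of "measure_pmf (hash_pmf c s r)"
        "potential r (k ^ c) \<theta> t \<G> X" UNIV "\<theta> powr t"] \<open>\<theta> > 0\<close>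
    by (simp add: integrable_measure_pmf_finite potential_nonneg)
  also have "\<dots> \<le> (2 ^ r) powr t * exp (- t * real (card X) / (2 * real (k ^ c) * 2 ^ r)) / \<theta> powr t"
    using expectation_potential_le[OF peeling X_keys \<open>t \<ge> 0\<close> _ exponent, of "k ^ c"] \<open>k > 0\<close>
    by (intro divide_right_mono) auto
  also have "\<dots> = ?tail"
    using \<open>\<theta> > 0\<close> by (simp add: powr_divide)
  finally have tail: "?P (\<lambda>h. \<theta> powr t \<le> potential r (k ^ c) \<theta> t \<G> X h) \<le> ?tail" .
  have "{h. \<theta> \<le> real (card (empty_bins r h X))}
      \<subseteq> {h. \<exists>G\<in>\<G>. \<not> spread (k ^ c) h G}
        \<union> {h. \<theta> powr t \<le> potential r (k ^ c) \<theta> t \<G> X h}"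
    using \<open>\<theta> > 0\<close> \<open>t \<ge> 0\<close> by (auto simp: potential_def intro: powr_mono2)
  then have "?prob \<le> ?P (\<lambda>h. \<exists>G\<in>\<G>. \<not> spread (k ^ c) h G)
      + ?P (\<lambda>h. \<theta> powr t \<le> potential r (k ^ c) \<theta> t \<G> X h)"
    by (intro order.trans[OF measure_pmf.finite_measure_mono measure_Un_le]) auto
  with crowded tail show ?thesis by linarith
qed

section \<open>Choice of parameters\<close>

lemma exp_le_one_minus_powr:
  fixes n a :: real
  assumes "n \<ge> 2" "a \<ge> 0"
  shows "exp (- 2 * a / n) \<le> (1 - 1 / n) powr a"
proof -
  have "exp (- (2 / n)) \<le> 1 - (2 / n) / 2"
    using assms by (intro exp_minus_le_linear) auto
  then have "exp (- (2 / n)) powr a \<le> (1 - 1 / n) powr a"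
    using assms by (intro powr_mono2) auto
  then show ?thesis
    by (simp add: exp_powr_real algebra_simps)
qed

lemma powr_power_Suc_divide_power:
  fixes n :: real
  assumes "n > 0"
  shows "(n powr a) ^ Suc k / n ^ k = n powr (a - (1 - a) * real k)"
proof -
  have "(n powr a) ^ Suc k / n ^ k = n powr (a * real (Suc k)) / n powr real k"
    using assms powr_realpow[of "n powr a" "Suc k"]
    by (simp only: powr_powr powr_realpow powr_gt_zero)
  also have "\<dots> = n powr (a - (1 - a) * real k)"
    by (simp add: algebra_simps flip: powr_diff)
  finally show ?thesis .
qed

lemma prob_not_spread_powr_le:
  assumes "A \<subseteq> keys c s" "real (card A) \<le> (2 ^ r) powr (1 - 1 / (2 * real c))"
    and "c \<ge> 1" and k_large: "real k \<ge> 2 * real c * (\<gamma> + 2)"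
  shows "measure_pmf.prob (hash_pmf c s r) {h. \<not> spread (k ^ c) h A} \<le> (2 ^ r) powr (- \<gamma>)"
proof -
  have "measure_pmf.prob (hash_pmf c s r) {h. \<not> spread (k ^ c) h A}
      \<le> ((2 ^ r) powr (1 - 1 / (2 * real c))) ^ Suc k / (2 ^ r) ^ k"
    by (rule prob_not_spread_le[OF assms(1,2)])
  also have "\<dots> = (2 ^ r) powr (1 - 1 / (2 * real c) - real k / (2 * real c))"
    by (simp add: powr_power_Suc_divide_power del: power_Suc)
  also have "\<dots> \<le> (2 ^ r) powr (- \<gamma>)"
  proof (rule powr_mono)
    have "\<gamma> + 2 \<le> real k / (2 * real c)"
      using k_large \<open>c \<ge> 1\<close> by (simp add: field_simps)
    moreover have "1 / (2 * real c) \<ge> 0" by simp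
    ultimately show "1 - 1 / (2 * real c) - real k / (2 * real c) \<le> - \<gamma>" by linarith
  qed simp
  finally show ?thesis .
qed

lemma powr_one_minus_inverse_le:
  fixes m n :: real
  assumes "n \<ge> 1" "0 \<le> m" "m \<le> n powr (1 + 1 / (2 * real c))" "c \<ge> 1"
  shows "m powr (1 - 1 / real c) \<le> n powr (1 - 1 / (2 * real c))"
proof -
  have "m powr (1 - 1 / real c) \<le> (n powr (1 + 1 / (2 * real c))) powr (1 - 1 / real c)"
    using assms by (intro powr_mono2) auto
  also have "\<dots> = n powr ((1 + 1 / (2 * real c)) * (1 - 1 / real c))"
    by (simp add: powr_powr)
  also have "\<dots> \<le> n powr (1 - 1 / (2 * real c))"
    using assms by (intro powr_mono) (auto simp: field_simps)
  finally show ?thesis .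
qed

lemma prob_empty_bins_ge_powr_le:
  assumes X_keys: "X \<subseteq> keys c s" "real (card X) \<le> (2 ^ r) powr (1 + 1 / (2 * real c))"
    and "c \<ge> 1" "\<theta> > 0" "t \<ge> 0" "k > 0" and k_large: "real k \<ge> 2 * real c * (\<gamma> + 2)"
    and small: "t \<le> 1 \<or> t * real (card X) powr (1 - 1 / real c) \<le> \<theta>"
  shows "measure_pmf.prob (hash_pmf c s r) {h. \<theta> \<le> real (card (empty_bins r h X))}
     \<le> (2 ^ r) powr (- \<gamma>)
       + (2 ^ r / \<theta>) powr t * exp (- t * real (card X) / (2 * real (k ^ c) * 2 ^ r))"
proof -
  define n :: real where "n = 2 ^ r"
  define M where "M = real (card X) powr (1 - 1 / real c)"
  have "n \<ge> 1" by (simp add: n_def)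
  have "M \<le> n powr (1 - 1 / (2 * real c))"
    unfolding M_def n_def using X_keys(2) \<open>c \<ge> 1\<close> by (intro powr_one_minus_inverse_le) auto
  then have "M ^ Suc k / n ^ k \<le> (n powr (1 - 1 / (2 * real c))) ^ Suc k / n ^ k"
    using \<open>n \<ge> 1\<close> by (intro divide_right_mono power_mono) (auto simp: M_def)
  also have "\<dots> = n powr (1 - 1 / (2 * real c) - real k / (2 * real c))"
    using \<open>n \<ge> 1\<close> by (simp add: powr_power_Suc_divide_power del: power_Suc)
  finally have "real (card X) * (M ^ Suc k / n ^ k)
      \<le> n powr (1 + 1 / (2 * real c)) * n powr (1 - 1 / (2 * real c) - real k / (2 * real c))"
    using X_keys(2) \<open>n \<ge> 1\<close> by (intro mult_mono) (auto simp: n_def M_def)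
  also have "\<dots> = n powr (2 - real k / (2 * real c))"
    by (simp flip: powr_add)
  also have "\<dots> \<le> n powr (- \<gamma>)"
    using k_large \<open>c \<ge> 1\<close> \<open>n \<ge> 1\<close> by (intro powr_mono) (auto simp: field_simps)
  finally show ?thesis
    using prob_empty_bins_ge_le[OF X_keys(1) \<open>c \<ge> 1\<close> \<open>\<theta> > 0\<close> \<open>t \<ge> 0\<close> \<open>k > 0\<close>, of M r] small
    by (simp add: M_def n_def)
qed

lemma prob_card_image_less_le:
  assumes X_keys: "X \<subseteq> keys c s" and "p \<le> q"
  shows "measure_pmf.prob (hash_pmf c s r) {h. real (card (h ` X)) < 2 ^ r * (1 - q)}
    \<le> measure_pmf.prob (hash_pmf c s r) {h. 2 ^ r * p < real (card (empty_bins r h X))}"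
proof (rule measure_pmf_Collect_mono)
  fix h assume hash: "h \<in> set_pmf (hash_pmf c s r)" and "real (card (h ` X)) < 2 ^ r * (1 - q)"
  moreover have "2 ^ r * p \<le> 2 ^ r * q"
    using \<open>p \<le> q\<close> by simp
  ultimately show "2 ^ r * p < real (card (empty_bins r h X))"
    unfolding card_empty_bins[OF hash X_keys] right_diff_distrib by linarith
qed

lemma prob_empty_bins_gt_exp_le_if_few_keys:
  fixes n a d :: real and c k r :: nat
  defines "n \<equiv> 2 ^ r" and "d \<equiv> real (k ^ c)"
  assumes X_keys: "X \<subseteq> keys c s" "real (card X) \<le> n powr (1 - 1 / (2 * real c))"
    and c_pos: "c \<ge> 1" and k_large: "k > 0" "real k \<ge> 2 * real c * (\<gamma> + 2)" and rate: "a * d \<le> 1"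
  shows "measure_pmf.prob (hash_pmf c s r)
      {h. n * exp (- a * real (card X) / n) < real (card (empty_bins r h X))} \<le> n powr (- \<gamma>)"
proof -
  have "n > 0" "d > 0"
    using k_large by (auto simp: n_def d_def)
  have "measure_pmf.prob (hash_pmf c s r)
      {h. n * exp (- a * real (card X) / n) < real (card (empty_bins r h X))}
    \<le> measure_pmf.prob (hash_pmf c s r) {h. \<not> spread (k ^ c) h X}"
  proof (rule measure_pmf_Collect_mono, rule notI)
    fix h assume hash: "h \<in> set_pmf (hash_pmf c s r)" and "spread (k ^ c) h X"
      and many_empty: "n * exp (- a * real (card X) / n) < real (card (empty_bins r h X))"
    have "n * (1 + (- a * real (card X) / n)) \<le> n * exp (- a * real (card X) / n)"
      using \<open>n > 0\<close> by (intro mult_left_mono exp_ge_add_one_self) simp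
    with many_empty have "real (card (h ` X)) < a * real (card X)"
      using \<open>n > 0\<close> by (simp add: card_empty_bins[OF hash X_keys(1), folded n_def] algebra_simps)
    then have "d * real (card (h ` X)) < d * (a * real (card X))"
      using \<open>d > 0\<close> by (rule mult_strict_left_mono)
    also have "\<dots> \<le> 1 * real (card X)"
      using mult_right_mono[OF rate, of "real (card X)"] by (simp add: mult_ac)
    also have "\<dots> \<le> d * real (card (h ` X))"
      using \<open>spread (k ^ c) h X\<close> unfolding d_def
      by (metis mult_1 of_nat_le_iff of_nat_mult spread_def)
    finally show False by simp
  qed
  also have "\<dots> \<le> n powr (- \<gamma>)"
    using X_keys c_pos k_large(2) unfolding n_def by (rule prob_not_spread_powr_le)
  finally show ?thesis .
qed

lemma powr_le_exp_mult_powr: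
  fixes m n a :: real
  assumes "c \<ge> 1" "n > 1" and many_keys: "n powr (1 - 1 / (2 * real c)) \<le> m"
    and decay: "a * m / n \<le> ln n / (4 * real c)"
  shows "n powr (1 / (4 * real c)) \<le> exp (- a * m / n) * m powr (1 / real c)"
proof -
  have "n powr (1 / (2 * real c)) \<le> n powr ((1 - 1 / (2 * real c)) * (1 / real c))"
    using assms by (intro powr_mono) (auto simp: field_simps)
  also have "\<dots> = (n powr (1 - 1 / (2 * real c))) powr (1 / real c)"
    by (simp only: powr_powr)
  also have "\<dots> \<le> m powr (1 / real c)"
    using many_keys by (intro powr_mono2) auto
  finally have "n powr (1 / (2 * real c)) \<le> m powr (1 / real c)" .
  moreover have "n powr (- 1 / (4 * real c)) \<le> exp (- a * m / n)"
    using decay \<open>n > 1\<close> by (simp add: powr_def)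
  ultimately have "n powr (- 1 / (4 * real c)) * n powr (1 / (2 * real c))
      \<le> exp (- a * m / n) * m powr (1 / real c)"
    by (intro mult_mono) auto
  then show ?thesis
    by (simp flip: powr_add)
qed

lemma powr_mult_exp_le_exp_minus:
  fixes n m a d t :: real
  assumes "n > 0" "m \<ge> 0" "d > 0" "t \<ge> 0" "4 * a * d \<le> 1"
  shows "(n / (n * exp (- a * m / n))) powr t * exp (- t * m / (2 * d * n))
    \<le> exp (- (t * m / n) / (4 * d))"
proof -
  have "n / (n * exp (- a * m / n)) = exp (a * m / n)"
    using \<open>n > 0\<close> by (simp add: exp_minus inverse_eq_divide)
  then have "(n / (n * exp (- a * m / n))) powr t * exp (- t * m / (2 * d * n))
      = exp (t * m / n * (a - 1 / (2 * d)))"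
    by (simp add: exp_powr_real algebra_simps flip: exp_add)
  also have "t * m / n * (a - 1 / (2 * d)) \<le> t * m / n * (- 1 / (4 * d))"
    using assms by (intro mult_left_mono) (auto simp: field_simps)
  finally show ?thesis by simp
qed

lemma prob_empty_bins_gt_exp_le_if_moderately_many_keys:
  fixes n a d :: real and c k r :: nat
  defines "n \<equiv> 2 ^ r" and "d \<equiv> real (k ^ c)"
  assumes X_keys: "X \<subseteq> keys c s" "n powr (1 - 1 / (2 * real c)) \<le> real (card X)"
      "real (card X) \<le> n powr (1 + 1 / (2 * real c))"
    and c_pos: "c \<ge> 1" and k_large: "k > 0" "real k \<ge> 2 * real c * (\<gamma> + 2)" and "n > 1"
    and rate: "4 * a * d \<le> 1" "a * real (card X) / n \<le> ln n / (4 * real c)"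
    and n_large: "exp (- (n powr (1 / (4 * real c))) / (4 * d)) \<le> n powr (- \<gamma>)"
  shows "measure_pmf.prob (hash_pmf c s r)
      {h. n * exp (- a * real (card X) / n) < real (card (empty_bins r h X))} \<le> 2 * n powr (- \<gamma>)"
proof -
  define m where "m = real (card X)"
  define \<theta> where "\<theta> = n * exp (- a * m / n)"
  define t where "t = \<theta> / m powr (1 - 1 / real c)"
  have "d > 0" using k_large by (simp add: d_def)
  have "0 < n powr (1 - 1 / (2 * real c))"
    using \<open>n > 1\<close> by simp
  with X_keys(2) have "m > 0" unfolding m_def by linarith
  then have exponent: "\<theta> > 0" "t \<ge> 0" "t * m powr (1 - 1 / real c) \<le> \<theta>"
    using \<open>n > 1\<close> by (auto simp: \<theta>_def t_def)
  have "t * m / n = exp (- a * m / n) * m powr (1 / real c)"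
    using \<open>m > 0\<close> \<open>n > 1\<close> by (simp add: t_def \<theta>_def powr_diff)
  then have exponent_ge: "n powr (1 / (4 * real c)) \<le> t * m / n"
    using powr_le_exp_mult_powr[OF c_pos \<open>n > 1\<close> X_keys(2) rate(2)] by (simp add: m_def)
  have "exp (- (t * m / n) / (4 * d)) \<le> exp (- (n powr (1 / (4 * real c))) / (4 * d))"
    using divide_right_mono[OF exponent_ge, of "4 * d"] \<open>d > 0\<close> by simp
  then have tail: "(n / \<theta>) powr t * exp (- t * m / (2 * d * n)) \<le> n powr (- \<gamma>)"
    using powr_mult_exp_le_exp_minus[of n m d t a] exponent(2)
      \<open>n > 1\<close> \<open>m > 0\<close> \<open>d > 0\<close> rate(1) n_large
    unfolding \<theta>_def by linarith
  have "measure_pmf.prob (hash_pmf c s r) {h. \<theta> < real (card (empty_bins r h X))}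
      \<le> measure_pmf.prob (hash_pmf c s r) {h. \<theta> \<le> real (card (empty_bins r h X))}"
    by (intro measure_pmf_Collect_mono) simp
  also have "\<dots> \<le> n powr (- \<gamma>) + (n / \<theta>) powr t * exp (- t * m / (2 * d * n))"
    using X_keys c_pos k_large exponent unfolding m_def n_def d_def
    by (intro prob_empty_bins_ge_powr_le) auto
  finally show ?thesis
    using tail by (simp add: \<theta>_def m_def)
qed

lemma mult_exp_minus_le_powr:
  fixes n z \<gamma> :: real
  assumes "n \<ge> 1" "(\<gamma> + 1) * ln n \<le> z"
  shows "n * exp (- z) \<le> n powr (- \<gamma>)"
proof -
  have "exp (- z) \<le> n powr (- (\<gamma> + 1))"
    using assms by (simp add: powr_def algebra_simps)
  then have "n * exp (- z) \<le> n * n powr (- (\<gamma> + 1))"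
    using assms by (intro mult_left_mono) auto
  then show ?thesis
    using assms by (simp add: powr_mult_base)
qed

lemma prob_empty_bins_nonempty_le_if_many_keys:
  fixes n d :: real and c k r :: nat
  defines "n \<equiv> 2 ^ r" and "d \<equiv> real (k ^ c)"
  assumes X_keys: "X \<subseteq> keys c s" "2 * d * (\<gamma> + 1) * n * ln n \<le> real (card X)"
    and c_pos: "c \<ge> 1" and k_large: "k > 0" "real k \<ge> 2 * real c * (\<gamma> + 2)" and "\<gamma> > 0"
    and n_large: "2 * d * (\<gamma> + 1) * n * ln n + 1 \<le> n powr (1 + 1 / (2 * real c))"
  shows "measure_pmf.prob (hash_pmf c s r) {h. empty_bins r h X \<noteq> {}} \<le> 2 * n powr (- \<gamma>)"
proof -
  define j where "j = nat \<lceil>2 * d * (\<gamma> + 1) * n * ln n\<rceil>"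
  have "d > 0" "n \<ge> 1"
    using k_large by (auto simp: d_def n_def)
  then have "2 * d * (\<gamma> + 1) * n * ln n \<ge> 0"
    using \<open>\<gamma> > 0\<close> by simp
  then have subset_size: "2 * d * (\<gamma> + 1) * n * ln n \<le> real j"
      "real j \<le> n powr (1 + 1 / (2 * real c))"
    using n_large by (auto simp: j_def real_nat_ceiling_ge) linarith
  have "j \<le> card X"
    using X_keys(2) unfolding j_def by (simp add: ceiling_le_iff nat_le_iff)
  then obtain Z where subset: "Z \<subseteq> X" "card Z = j"
    by (meson obtain_subset_with_card_n)
  have "measure_pmf.prob (hash_pmf c s r) {h. empty_bins r h X \<noteq> {}}
      \<le> measure_pmf.prob (hash_pmf c s r) {h. 1 \<le> real (card (empty_bins r h Z))}"
  proof (rule measure_pmf_Collect_mono)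
    fix h assume "empty_bins r h X \<noteq> {}"
    moreover have "empty_bins r h X \<subseteq> empty_bins r h Z"
      using subset(1) by (auto simp: empty_bins_def)
    moreover have "finite (empty_bins r h Z)"
      by (simp add: empty_bins_def)
    ultimately show "1 \<le> real (card (empty_bins r h Z))"
      by (auto simp: Suc_le_eq card_gt_0_iff)
  qed
  also have "\<dots> \<le> n powr (- \<gamma>) + (n / 1) powr 1 * exp (- 1 * real (card Z) / (2 * d * n))"
    using X_keys(1) subset subset_size(2) c_pos k_large unfolding n_def d_def
    by (intro prob_empty_bins_ge_powr_le) auto
  also have "(n / 1) powr 1 * exp (- 1 * real (card Z) / (2 * d * n)) \<le> n powr (- \<gamma>)"
    using mult_exp_minus_le_powr[OF \<open>n \<ge> 1\<close>, of \<gamma> "real j / (2 * d * n)"] subset_size(1) subset(2)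
      \<open>d > 0\<close> \<open>n \<ge> 1\<close>
    by (simp add: field_simps)
  finally show ?thesis by simp
qed

lemma prob_empty_bins_gt_exp_le:
  fixes n a d \<kappa> \<gamma> :: real and c k r :: nat
  defines "n \<equiv> 2 ^ r" and "d \<equiv> real (k ^ c)" and "\<kappa> \<equiv> 2 * d * (\<gamma> + 1)"
  assumes X_keys: "X \<subseteq> keys c s" and c_pos: "c \<ge> 1" and "\<gamma> > 0"
    and k_large: "k > 0" "real k \<ge> 2 * real c * (\<gamma> + 2)"
    and rate: "a > 0" "4 * a * d \<le> 1" "a * \<kappa> \<le> 1 / (4 * real c)"
    and n_large: "n > 1" "\<kappa> * n * ln n + 1 \<le> n powr (1 + 1 / (2 * real c))"
      "exp (- (n powr (1 / (4 * real c))) / (4 * d)) \<le> n powr (- \<gamma>)"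
  shows "measure_pmf.prob (hash_pmf c s r)
      {h. n * exp (- a * real (card X) / n) < real (card (empty_bins r h X))} \<le> 2 * n powr (- \<gamma>)"
    (is "?prob \<le> _")
proof -
  define m where "m = real (card X)"
  consider (few) "m \<le> n powr (1 - 1 / (2 * real c))"
    | (moderate) "n powr (1 - 1 / (2 * real c)) \<le> m" "m \<le> \<kappa> * n * ln n"
    | (many) "\<kappa> * n * ln n \<le> m"
    by linarith
  then show ?thesis
  proof cases
    case few
    have "0 < a * d"
      using rate(1) k_large(1) by (simp add: d_def)
    then have "a * d \<le> 1"
      using rate(2) by simp
    then have "?prob \<le> n powr (- \<gamma>)"
      using few X_keys c_pos k_large unfolding m_def n_def d_def
      by (intro prob_empty_bins_gt_exp_le_if_few_keys) auto
    also have "\<dots> \<le> 2 * n powr (- \<gamma>)" by simp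
    finally show ?thesis .
  next
    case moderate
    have "a * m / n \<le> a * \<kappa> * ln n"
      using moderate(2) rate(1) n_large(1) by (simp add: field_simps)
    also have "\<dots> \<le> ln n / (4 * real c)"
      using mult_right_mono[OF rate(3), of "ln n"] n_large(1) by simp
    finally show ?thesis
      using moderate X_keys c_pos k_large rate(2) n_large unfolding m_def n_def d_def
      by (intro prob_empty_bins_gt_exp_le_if_moderately_many_keys) auto
  next
    case many
    have "?prob \<le> measure_pmf.prob (hash_pmf c s r) {h. empty_bins r h X \<noteq> {}}"
      using n_large(1) by (intro measure_pmf_Collect_mono) (auto simp: mult_less_0_iff)
    also have "\<dots> \<le> 2 * n powr (- \<gamma>)"
      using many X_keys c_pos k_large n_large(2) \<open>\<gamma> > 0\<close> unfolding m_def n_def d_def \<kappa>_def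
      by (intro prob_empty_bins_nonempty_le_if_many_keys) auto
    finally show ?thesis .
  qed
qed

lemma eventually_prob_empty_bins_gt_exp_le:
  fixes \<gamma> :: real
  assumes c_pos: "c \<ge> 1" and "\<gamma> > 0"
  obtains a N :: real where "a > 0"
    "\<And>s r X. X \<subseteq> keys c s \<Longrightarrow> N \<le> 2 ^ r \<Longrightarrow> measure_pmf.prob (hash_pmf c s r)
        {h. 2 ^ r * exp (- a * real (card X) / 2 ^ r) < real (card (empty_bins r h X))}
      \<le> 2 * (2 ^ r) powr (- \<gamma>)"
proof -
  define k where "k = nat \<lceil>2 * real c * (\<gamma> + 2)\<rceil>"
  define d where "d = real (k ^ c)"
  define \<kappa> where "\<kappa> = 2 * d * (\<gamma> + 1)"
  define a where "a = 1 / (4 * d + 4 * real c * \<kappa>)"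
  have "0 < 2 * real c * (\<gamma> + 2)" using assms by simp
  moreover have "real k \<ge> 2 * real c * (\<gamma> + 2)"
    unfolding k_def by (rule real_nat_ceiling_ge)
  ultimately have k_large: "k > 0" "real k \<ge> 2 * real c * (\<gamma> + 2)"
    by (auto intro: gr0I)
  then have "d > 0" by (simp add: d_def)
  then have "\<kappa> > 0" using assms by (simp add: \<kappa>_def)
  have rate: "a > 0" "4 * a * d \<le> 1" "a * \<kappa> \<le> 1 / (4 * real c)"
    using \<open>d > 0\<close> \<open>\<kappa> > 0\<close> c_pos by (auto simp: a_def divide_simps add_pos_pos)
  have "\<forall>\<^sub>F x in at_top. x > 1 \<and> \<kappa> * x * ln x + 1 \<le> x powr (1 + 1 / (2 * real c)) \<and>
      exp (- (x powr (1 / (4 * real c))) / (4 * d)) \<le> x powr (- \<gamma>)"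
    using assms \<open>d > 0\<close> \<open>\<kappa> > 0\<close> by (intro eventually_conj; real_asymp)
  then obtain N where "\<forall>x\<ge>N. x > 1 \<and> \<kappa> * x * ln x + 1 \<le> x powr (1 + 1 / (2 * real c)) \<and>
      exp (- (x powr (1 / (4 * real c))) / (4 * d)) \<le> x powr (- \<gamma>)"
    unfolding eventually_at_top_linorder by blast
  then show ?thesis
    using rate k_large c_pos \<open>\<gamma> > 0\<close> unfolding \<kappa>_def d_def
    by (intro that[of a N] prob_empty_bins_gt_exp_le[where k = k]) auto
qed

lemma le_mult_powr_minus_if_large:
  fixes p n :: real
  assumes "p \<le> 1" "n > 0" "\<gamma> \<ge> 0" "B \<ge> 0" and large: "N \<le> n \<Longrightarrow> p \<le> B * n powr (- \<gamma>)"
  shows "p \<le> (B + N powr \<gamma>) * n powr (- \<gamma>)"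
proof (cases "N \<le> n")
  case True
  have "B * n powr (- \<gamma>) \<le> (B + N powr \<gamma>) * n powr (- \<gamma>)"
    by (intro mult_right_mono) auto
  with large[OF True] show ?thesis by simp
next
  case False
  note \<open>p \<le> 1\<close>
  also have "1 \<le> (N / n) powr \<gamma>"
    using False assms(2,3) by (intro ge_one_powr_ge_zero) auto
  also have "\<dots> = N powr \<gamma> * n powr (- \<gamma>)"
    using False \<open>n > 0\<close> by (simp add: powr_divide powr_minus_divide)
  also have "\<dots> \<le> (B + N powr \<gamma>) * n powr (- \<gamma>)"
    using \<open>B \<ge> 0\<close> by (intro mult_right_mono) auto
  finally show ?thesis .
qed

theorem theorem2:
  fixes c :: nat and \<gamma> :: real
  assumes "c \<ge> 1" and "\<gamma> > 0"
  shows "\<exists>\<beta>::real. \<beta> > 0 \<and> (\<exists>C::real. \<forall>(s::nat) (r::nat) (X::nat list set).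
           X \<subseteq> keys c s \<longrightarrow>
           measure_pmf.prob (table_pmf c s r)
             {T. real (card (tab_hash c T ` X))
                   < real (2^r) * (1 - (1 - 1 / real (2^r)) powr (real (card X) / \<beta>))}
           \<le> C * real (2^r) powr (- \<gamma>))"
proof -
  obtain a N :: real where "a > 0" and tail: "\<And>s r X. X \<subseteq> keys c s \<Longrightarrow> N \<le> 2 ^ r \<Longrightarrow>
      measure_pmf.prob (hash_pmf c s r)
        {h. 2 ^ r * exp (- a * real (card X) / 2 ^ r) < real (card (empty_bins r h X))}
      \<le> 2 * (2 ^ r) powr (- \<gamma>)"
    using eventually_prob_empty_bins_gt_exp_le[OF assms] by blast
  have "measure_pmf.prob (hash_pmf c s r) {h. real (card (h ` X))
        < 2 ^ r * (1 - (1 - 1 / 2 ^ r) powr (real (card X) / (2 / a)))}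
      \<le> (2 + (max N 2) powr \<gamma>) * (2 ^ r) powr (- \<gamma>)"
    if X_keys: "X \<subseteq> keys c s" for s r X
  proof (rule le_mult_powr_minus_if_large)
    assume large: "max N 2 \<le> 2 ^ r"
    then have "exp (- a * real (card X) / 2 ^ r) \<le> (1 - 1 / 2 ^ r) powr (real (card X) / (2 / a))"
      using exp_le_one_minus_powr[of "2 ^ r" "real (card X) / (2 / a)"] \<open>a > 0\<close>
      by (simp add: mult.commute)
    note prob_card_image_less_le[OF X_keys this]
    also note tail[OF X_keys]
    finally show "measure_pmf.prob (hash_pmf c s r) {h. real (card (h ` X))
        < 2 ^ r * (1 - (1 - 1 / 2 ^ r) powr (real (card X) / (2 / a)))} \<le> 2 * (2 ^ r) powr (- \<gamma>)"
      using large by simp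
  qed (use assms in auto)
  with \<open>a > 0\<close> show ?thesis
    by (intro exI[of _ "2 / a"] exI[of _ "2 + (max N 2) powr \<gamma>"] conjI allI impI)
       (simp_all add: hash_pmf_def vimage_def)
qed

end
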